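(* Let $n$ be a multiple of $6$ and let $C_n$ be the $n$-cycle. For every symmetric strategy for rendezvous on $C_n$ and every $T\ge0$, \[ \Pr[\text{no rendezvous in the first } T \text{ steps}]\ge \frac12\,3^{-6T/n}, \] where the players are counted as having rendezvoused at a step if they are at the same vertex at the same time, or if they traverse the same edge in opposite directions during the same step.
   Context: Rendezvous on $C_n$ (vertices $\mathbb{Z}_n$, $i$ adjacent to $i\pm1$): each player labels the vertices privately, and the two labelings differ by an automorphism $\pi$ chosen uniformly at random from $\mathrm{Aut}(C_n)$, the dihedral group (maps $x\mapsto x+s$ and $x\mapsto -x+s$ mod $n$). A walk of length $T$ is a sequence $(v_0,\dots,v_T)$ with $v_{t+1}\in\{v_t-1,v_t,v_t+1\}$ mod $n$, including a starting vertex chosen by the player. A symmetric strategy is a distribution over such walks from which both players sample independently, independently of $\pi$. *)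

theory Defs
  imports "HOL-Probability.Probability"
begin

definition cycle_verts :: "nat \<Rightarrow> int set" where
  "cycle_verts n = {0..<int n}"

definition cycle_adj :: "nat \<Rightarrow> int \<Rightarrow> int \<Rightarrow> bool" where
  "cycle_adj n x y \<longleftrightarrow> x \<in> cycle_verts n \<and> y \<in> cycle_verts n \<and>
     (y = (x + 1) mod int n \<or> y = (x - 1) mod int n)"

(* Extensional functions, so that every automorphism is represented exactly once
   and the uniform distribution on this set is the uniform distribution on Aut(C_n). *)
definition cycle_aut :: "nat \<Rightarrow> (int \<Rightarrow> int) set" where
  "cycle_aut n = {\<pi> \<in> extensional (cycle_verts n).
     bij_betw \<pi> (cycle_verts n) (cycle_verts n) \<and>
     (\<forall>x\<in>cycle_verts n. \<forall>y\<in>cycle_verts n. cycle_adj n (\<pi> x) (\<pi> y) \<longleftrightarrow> cycle_adj n x y)}"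

definition cycle_walks :: "nat \<Rightarrow> nat \<Rightarrow> int list set" where
  "cycle_walks n T = {v. length v = T + 1 \<and> set v \<subseteq> cycle_verts n \<and>
     (\<forall>t<T. v ! (t + 1) \<in> {(v ! t - 1) mod int n, v ! t, (v ! t + 1) mod int n})}"

definition symmetric_strategy :: "nat \<Rightarrow> nat \<Rightarrow> int list pmf \<Rightarrow> bool" where
  "symmetric_strategy n T p \<longleftrightarrow> set_pmf p \<subseteq> cycle_walks n T"

(* The first player's walk v, the second player's walk w in the second player's own labels,
   and the relabeling \<pi> from the second player's labels to the first player's; all independent. *)
definition rendezvous_experiment :: "nat \<Rightarrow> int list pmf \<Rightarrow> (int list \<times> int list \<times> (int \<Rightarrow> int)) pmf" where
  "rendezvous_experiment n p = pair_pmf p (pair_pmf p (pmf_of_set (cycle_aut n)))"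

(* Both walks are in the same labels. Sharing the starting vertex (t = 0) counts as a rendezvous. *)
definition rendezvous :: "nat \<Rightarrow> int list \<Rightarrow> int list \<Rightarrow> bool" where
  "rendezvous T v u \<longleftrightarrow>
     (\<exists>t\<le>T. v ! t = u ! t) \<or>
     (\<exists>t<T. v ! t \<noteq> v ! (t + 1) \<and> v ! t = u ! (t + 1) \<and> v ! (t + 1) = u ! t)"

definition no_rendezvous_prob :: "nat \<Rightarrow> nat \<Rightarrow> int list pmf \<Rightarrow> real" where
  "no_rendezvous_prob n T p =
     measure_pmf.prob (rendezvous_experiment n p) {(v, w, \<pi>). \<not> rendezvous T v (map \<pi> w)}"

lemma finite_cycle_aut: "finite (cycle_aut n)"
proof (rule finite_subset)
  show "cycle_aut n \<subseteq> cycle_verts n \<rightarrow>\<^sub>E cycle_verts n"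
    by (auto simp: cycle_aut_def PiE_def bij_betw_def)
  show "finite (cycle_verts n \<rightarrow>\<^sub>E cycle_verts n)"
    by (intro finite_PiE) (auto simp: cycle_verts_def)
qed

lemma mod_eq_iff_dvd: "a mod int n = b mod int n \<longleftrightarrow> int n dvd a - b"
  by (simp add: mod_eq_dvd_iff)

lemma dihedral_in_cycle_aut:
  assumes n: "n \<ge> 3" and e: "e = 1 \<or> e = (-1::int)"
  shows "restrict (\<lambda>x. (e * x + s) mod int n) (cycle_verts n) \<in> cycle_aut n"
proof -
  let ?f = "\<lambda>x. (e * x + s) mod int n"
  let ?V = "cycle_verts n"
  have ee: "e * e = 1" using e by auto
  have V: "?f x \<in> ?V" for x using n by (simp add: cycle_verts_def)
  have inj: "inj_on ?f ?V"
  proof (rule inj_onI)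
    fix x y assume xy: "x \<in> ?V" "y \<in> ?V" "?f x = ?f y"
    then have "int n dvd (e * x + s) - (e * y + s)" by (simp add: mod_eq_iff_dvd)
    then have "int n dvd e * ((e * x + s) - (e * y + s))" by (rule dvd_mult)
    also have "e * ((e * x + s) - (e * y + s)) = (e * e) * (x - y)" by (simp add: algebra_simps)
    finally have "int n dvd x - y" by (simp add: ee)
    then have "x mod int n = y mod int n" by (simp add: mod_eq_iff_dvd)
    then show "x = y" using xy by (simp add: cycle_verts_def)
  qed
  have bij: "bij_betw ?f ?V ?V"
    using inj V endo_inj_surj[of ?V ?f]
    by (simp add: bij_betw_def cycle_verts_def image_subset_iff)
  have adj: "cycle_adj n (?f x) (?f y) \<longleftrightarrow> cycle_adj n x y" if "x \<in> ?V" "y \<in> ?V" for x y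
  proof -
    have step: "?f y = (?f x + d) mod int n \<longleftrightarrow> y = (x + e * d) mod int n" for d
    proof -
      have "?f y = (?f x + d) mod int n \<longleftrightarrow> (e * y + s) mod int n = (e * x + s + d) mod int n"
        by (simp add: mod_simps)
      also have "\<dots> \<longleftrightarrow> int n dvd (e * y + s) - (e * x + s + d)" by (rule mod_eq_iff_dvd)
      also have "(e * y + s) - (e * x + s + d) = e * (y - (x + e * d))"
        using e by auto
      also have "int n dvd \<dots> \<longleftrightarrow> int n dvd y - (x + e * d)" using e by (auto simp: dvd_diff_commute)
      also have "\<dots> \<longleftrightarrow> y mod int n = (x + e * d) mod int n" by (simp add: mod_eq_iff_dvd)
      also have "y mod int n = y" using that by (simp add: cycle_verts_def)
      finally show ?thesis .
    qed
    show ?thesis using step[of 1] step[of "-1"] e that V by (auto simp: cycle_adj_def)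
  qed
  show ?thesis using bij adj by (simp add: cycle_aut_def cong: bij_betw_cong)
qed

lemma cycle_aut_eq_dihedral:
  assumes n: "n \<ge> 3"
  shows "cycle_aut n =
    (\<lambda>s. restrict (\<lambda>x. (x + s) mod int n) (cycle_verts n)) ` cycle_verts n \<union>
    (\<lambda>s. restrict (\<lambda>x. (- x + s) mod int n) (cycle_verts n)) ` cycle_verts n"
    (is "_ = ?T \<union> ?R")
proof (intro equalityI subsetI)
  fix \<pi> assume "\<pi> \<in> ?T \<union> ?R"
  then show "\<pi> \<in> cycle_aut n"
    using dihedral_in_cycle_aut[OF n, of 1] dihedral_in_cycle_aut[OF n, of "-1"] by auto
next
  fix \<pi> assume \<pi>: "\<pi> \<in> cycle_aut n"
  let ?V = "cycle_verts n"
  define s where "s = \<pi> 0"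
  have ext: "\<pi> \<in> extensional ?V" and bij: "bij_betw \<pi> ?V ?V"
    and adj: "\<And>x y. x \<in> ?V \<Longrightarrow> y \<in> ?V \<Longrightarrow> cycle_adj n (\<pi> x) (\<pi> y) \<longleftrightarrow> cycle_adj n x y"
    using \<pi> by (auto simp: cycle_aut_def)
  have inV: "\<pi> x \<in> ?V" if "x \<in> ?V" for x using bij that by (auto simp: bij_betw_def)
  have inj: "\<pi> x = \<pi> y \<Longrightarrow> x = y" if "x \<in> ?V" "y \<in> ?V" for x y
    using bij that by (auto simp: bij_betw_def inj_on_def)
  have V0: "0 \<in> ?V" "1 \<in> ?V" using n by (auto simp: cycle_verts_def)
  have sV: "s \<in> ?V" unfolding s_def by (rule inV[OF V0(1)])
  have nxt: "\<pi> (int k + 1) = (\<pi> (int k) + 1) mod int n \<or>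
       \<pi> (int k + 1) = (\<pi> (int k) - 1) mod int n"
    if "k + 1 < n" for k
  proof -
    have "int k \<in> ?V" "int k + 1 \<in> ?V" using that by (auto simp: cycle_verts_def)
    moreover from this have "cycle_adj n (int k) (int k + 1)"
      by (auto simp: cycle_adj_def cycle_verts_def)
    ultimately show ?thesis using adj[of "int k" "int k + 1"] by (auto simp: cycle_adj_def)
  qed
  obtain e :: int where e: "e = 1 \<or> e = -1" and p1: "\<pi> 1 = (s + e) mod int n"
  proof -
    have "\<pi> 1 = (s + 1) mod int n \<or> \<pi> 1 = (s + -1) mod int n"
      using nxt[of 0] n by (simp add: s_def)
    then show ?thesis using that[of 1] that[of "-1"] by blast
  qed
  have main: "k < n \<Longrightarrow> \<pi> (int k) = (e * int k + s) mod int n" for k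
  proof (induction k rule: less_induct)
    case (less k)
    consider "k = 0" | "k = 1" | j where "k = j + 2"
    proof -
      have "k = 0 \<or> k = 1 \<or> k = (k - 2) + 2" by arith
      then show ?thesis using that by blast
    qed
    then show ?case
    proof cases
      case 1
      then show ?thesis using sV by (simp add: s_def cycle_verts_def)
    next
      case 2
      then show ?thesis using p1 by (simp add: add.commute)
    next
      case 3
      have a: "\<pi> (int j) = (e * int j + s) mod int n" using less 3 by simp
      have b: "\<pi> (int j + 1) = (e * (int j + 1) + s) mod int n"
        using less.IH[of "j + 1"] less.prems 3 by (simp add: add.commute)
      have "\<pi> (int j + 2) \<noteq> \<pi> (int j)"
        using inj[of "int j + 2" "int j"] less.prems 3 by (auto simp: cycle_verts_def)
      moreover have "\<pi> (int j + 2) = (\<pi> (int j + 1) + 1) mod int n \<or> \<pi> (int j + 2) = (\<pi> (int j + 1) - 1) mod int n"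
        using nxt[of "j + 1"] less.prems 3 by (simp add: add.commute)
      ultimately have "\<pi> (int j + 2) = (e * (int j + 2) + s) mod int n"
        using e a b by (auto simp: mod_simps algebra_simps)
      then show ?thesis using 3 by (simp add: add.commute)
    qed
  qed
  have "\<pi> = restrict (\<lambda>x. (e * x + s) mod int n) ?V"
  proof (rule extensionalityI[OF ext])
    fix x assume "x \<in> ?V"
    then show "\<pi> x = restrict (\<lambda>x. (e * x + s) mod int n) ?V x"
      using main[of "nat x"] by (simp add: cycle_verts_def nat_less_iff)
  qed simp
  then show "\<pi> \<in> ?T \<union> ?R" using e sV by auto
qed

end

theory Submission
  imports Defs
begin

text \<open>
  Write \<open>n = 6 m\<close>. Relabelling both walks by independent uniform automorphisms turns the
  experiment into one where two independent samples of a single automorphism-invariant distribution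
  are compared directly. Cut the cycle into six arcs of length \<open>m\<close> and record in which arc a walk
  is at the anchor times \<open>a, a + m, \<dots>, a + q m\<close>, where \<open>q = T div m\<close>. Between two anchor times a
  walk changes its arc by \<open>-1\<close>, \<open>0\<close> or \<open>1\<close>, so there are at most \<open>3 ^ q\<close> sequences of arc changes,
  and two independent walks have the same sequence with probability at least \<open>3 ^ -q\<close>. In that case
  their arc difference is the same at all anchor times. If it is \<open>2\<close>, \<open>3\<close> or \<open>4\<close>, the walks have
  distance at least \<open>m + 1\<close> at the anchor times, which is too far to meet or to swap in between.
  By invariance under translation by multiples of \<open>m\<close>, this happens for half of the arc differences.
  The offset \<open>a\<close> is chosen such that the time before the first and after the last anchor is at most
  \<open>m / 2\<close>; this gives the exponent \<open>q\<close> instead of \<open>q + 1\<close>.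
\<close>

section \<open>Collision probability\<close>

text \<open>Cauchy-Schwarz for the masses on \<open>C\<close>, which sum to 1: the sum of their
  squares is the collision probability.\<close>

lemma prob_pair_pmf_eq_ge:
  fixes M :: "'a pmf"
  assumes "finite C" "set_pmf M \<subseteq> C"
  shows "1 / real (card C) \<le> measure_pmf.prob (pair_pmf M M) {(x, y). x = y}"
proof -
  have "1 = (\<Sum>x\<in>C. pmf M x)"
    using sum_pmf_eq_1[OF assms] by simp
  also have "\<dots>\<^sup>2 \<le> real (card C) * (\<Sum>x\<in>C. (pmf M x)\<^sup>2)"
    using sum_squared_le_sum_of_squares[of "pmf M" C] by (simp add: mult.commute)
  finally have cs: "1 \<le> real (card C) * (\<Sum>x\<in>C. (pmf M x)\<^sup>2)" by simp
  have "C \<noteq> {}" using assms set_pmf_not_empty[of M] by blast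
  then have "card C > 0" using assms(1) by (simp add: card_gt_0_iff)
  with cs have "1 / real (card C) \<le> (\<Sum>x\<in>C. (pmf M x)\<^sup>2)"
    by (simp add: field_simps)
  also have "\<dots> = (\<Sum>x\<in>C. pmf (pair_pmf M M) (x, x))"
    by (simp add: pmf_pair power2_eq_square)
  also have "\<dots> = (\<Sum>z\<in>(\<lambda>x. (x, x)) ` C. pmf (pair_pmf M M) z)"
    by (subst sum.reindex) (auto simp: inj_on_def)
  also have "\<dots> = measure_pmf.prob (pair_pmf M M) ((\<lambda>x. (x, x)) ` C)"
    using assms(1) by (simp add: measure_measure_pmf_finite)
  also have "\<dots> \<le> measure_pmf.prob (pair_pmf M M) {(x, y). x = y}"
    by (intro measure_pmf.finite_measure_mono) auto
  finally show ?thesis .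
qed

section \<open>Walks and automorphisms\<close>

lemma cycle_walks_nth_mem:
  assumes "v \<in> cycle_walks n T" "t \<le> T"
  shows "v ! t \<in> cycle_verts n"
  using assms nth_mem[of t v] by (auto simp: cycle_walks_def)

text \<open>Automorphisms are defined through adjacency, so this form of the step condition
  transfers along them directly.\<close>

lemma cycle_walks_iff_adj:
  "v \<in> cycle_walks n T \<longleftrightarrow> length v = T + 1 \<and> set v \<subseteq> cycle_verts n \<and>
     (\<forall>t<T. v ! (t + 1) = v ! t \<or> cycle_adj n (v ! t) (v ! (t + 1)))"
proof -
  have "v ! (t + 1) \<in> {(v ! t - 1) mod int n, v ! t, (v ! t + 1) mod int n} \<longleftrightarrow>
      v ! (t + 1) = v ! t \<or> cycle_adj n (v ! t) (v ! (t + 1))"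
    if "length v = T + 1" "set v \<subseteq> cycle_verts n" "t < T" for t
  proof -
    have "v ! t \<in> cycle_verts n" "v ! (t + 1) \<in> cycle_verts n"
      using that by (auto intro!: subsetD[OF that(2)] nth_mem)
    then show ?thesis unfolding cycle_adj_def by blast
  qed
  then show ?thesis unfolding cycle_walks_def by blast
qed

lemma map_cycle_aut_walk:
  assumes "g \<in> cycle_aut n" "v \<in> cycle_walks n T"
  shows "map g v \<in> cycle_walks n T"
proof -
  have g: "g x \<in> cycle_verts n" if "x \<in> cycle_verts n" for x
    using assms(1) that by (auto simp: cycle_aut_def bij_betw_def)
  have adj: "cycle_adj n x y \<Longrightarrow> cycle_adj n (g x) (g y)" for x y
    using assms(1) by (auto simp: cycle_aut_def cycle_adj_def)
  show ?thesis
    using assms(2) g adj unfolding cycle_walks_iff_adj by auto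
qed

lemma rendezvous_map_cycle_aut:
  assumes "g \<in> cycle_aut n" "v \<in> cycle_walks n T" "u \<in> cycle_walks n T"
  shows "rendezvous T (map g v) (map g u) \<longleftrightarrow> rendezvous T v u"
proof -
  have inj: "inj_on g (cycle_verts n)"
    using assms(1) by (auto simp: cycle_aut_def bij_betw_def)
  have len: "length v = T + 1" "length u = T + 1"
    using assms by (auto simp: cycle_walks_def)
  have eq: "g (x ! t) = g (y ! t') \<longleftrightarrow> x ! t = y ! t'"
    if "x \<in> {v, u}" "y \<in> {v, u}" "t \<le> T" "t' \<le> T" for x y t t'
    using inj_on_eq_iff[OF inj] cycle_walks_nth_mem[OF assms(2)] cycle_walks_nth_mem[OF assms(3)] that
    by blast
  show ?thesis
    unfolding rendezvous_def using eq len
    by (intro arg_cong2[where f = "(\<or>)"] ex_cong1) (auto simp: nth_map simp del: map_map)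
qed

lemma compose_cycle_aut:
  assumes "g \<in> cycle_aut n" "h \<in> cycle_aut n"
  shows "compose (cycle_verts n) g h \<in> cycle_aut n"
proof -
  have "h x \<in> cycle_verts n" if "x \<in> cycle_verts n" for x
    using assms(2) that by (auto simp: cycle_aut_def bij_betw_def)
  moreover have "bij_betw (compose (cycle_verts n) g h) (cycle_verts n) (cycle_verts n)"
    using assms by (intro bij_betw_compose) (auto simp: cycle_aut_def)
  ultimately show ?thesis
    using assms by (auto simp: cycle_aut_def compose_eq)
qed

lemma map_compose_cycle_walk:
  assumes "w \<in> cycle_walks n T"
  shows "map (compose (cycle_verts n) g h) w = map g (map h w)"
  using assms by (auto simp: cycle_walks_def compose_eq)

lemma cycle_aut_nonempty: "n \<ge> 3 \<Longrightarrow> cycle_aut n \<noteq> {}"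
  using dihedral_in_cycle_aut[of n 1 0] by blast

text \<open>Left multiplication by a group element permutes the finite group: it is injective, and
  finiteness gives surjectivity.\<close>

lemma map_pmf_compose_cycle_aut:
  assumes n: "n \<ge> 3" and g: "g \<in> cycle_aut n"
  shows "map_pmf (compose (cycle_verts n) g) (pmf_of_set (cycle_aut n)) = pmf_of_set (cycle_aut n)"
proof (rule map_pmf_of_set_bij_betw)
  have "inj_on (compose (cycle_verts n) g) (cycle_aut n)"
  proof (rule inj_onI)
    fix h k assume hk: "h \<in> cycle_aut n" "k \<in> cycle_aut n"
      "compose (cycle_verts n) g h = compose (cycle_verts n) g k"
    show "h = k"
    proof (rule extensionalityI)
      show "h \<in> extensional (cycle_verts n)" "k \<in> extensional (cycle_verts n)"
        using hk by (auto simp: cycle_aut_def)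
      fix x assume x: "x \<in> cycle_verts n"
      have "g (h x) = g (k x)" using fun_cong[OF hk(3), of x] x by (simp add: compose_eq)
      moreover have "h x \<in> cycle_verts n" "k x \<in> cycle_verts n"
        using hk x by (auto simp: cycle_aut_def bij_betw_def)
      ultimately show "h x = k x"
        using g by (auto simp: cycle_aut_def bij_betw_def inj_on_def)
    qed
  qed
  moreover have "compose (cycle_verts n) g ` cycle_aut n \<subseteq> cycle_aut n"
    using compose_cycle_aut[OF g] by blast
  ultimately show "bij_betw (compose (cycle_verts n) g) (cycle_aut n) (cycle_aut n)"
    using endo_inj_surj[OF finite_cycle_aut] by (auto simp: bij_betw_def)
qed (use cycle_aut_nonempty[OF n] finite_cycle_aut in auto)

section \<open>The symmetrised strategy\<close>

definition symmetrised :: "nat \<Rightarrow> int list pmf \<Rightarrow> int list pmf" where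
  "symmetrised n p = bind_pmf p (\<lambda>v. map_pmf (\<lambda>g. map g v) (pmf_of_set (cycle_aut n)))"

context
  fixes n T :: nat and p :: "int list pmf"
  assumes n: "n \<ge> 3" and p: "set_pmf p \<subseteq> cycle_walks n T"
begin

private lemma set_pmf_cycle_aut: "set_pmf (pmf_of_set (cycle_aut n)) = cycle_aut n"
  using cycle_aut_nonempty[OF n] finite_cycle_aut by simp

lemma set_pmf_symmetrised: "set_pmf (symmetrised n p) \<subseteq> cycle_walks n T"
  using p map_cycle_aut_walk by (auto simp: symmetrised_def set_pmf_cycle_aut)

text \<open>The extra relabelling \<open>g\<close> is absorbed by the uniform automorphism inside
  \<open>symmetrised\<close>.\<close>

lemma map_pmf_symmetrised:
  assumes g: "g \<in> cycle_aut n"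
  shows "map_pmf (map g) (symmetrised n p) = symmetrised n p"
proof -
  have "map_pmf (map g) (map_pmf (\<lambda>h. map h v) (pmf_of_set (cycle_aut n))) =
      map_pmf (\<lambda>h. map h v) (pmf_of_set (cycle_aut n))" if "v \<in> set_pmf p" for v
  proof -
    have "v \<in> cycle_walks n T" using that p by blast
    then have "map g \<circ> (\<lambda>h. map h v) = (\<lambda>h. map h v) \<circ> compose (cycle_verts n) g"
      by (simp only: fun_eq_iff comp_def map_compose_cycle_walk) simp
    then show ?thesis
      by (simp add: pmf.map_comp map_pmf_compose_cycle_aut[OF n g] flip: pmf.map_comp[of _ "compose _ _"])
  qed
  then show ?thesis
    unfolding symmetrised_def map_bind_pmf by (intro bind_pmf_cong) auto
qed

lemma no_rendezvous_prob_symmetrised: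
  "no_rendezvous_prob n T p =
    measure_pmf.prob (pair_pmf (symmetrised n p) (symmetrised n p)) {(v, w). \<not> rendezvous T v w}"
proof -
  let ?U = "pmf_of_set (cycle_aut n)"
  \<comment> \<open>For fixed \<open>g\<close>, the uniform \<open>h\<close> may be replaced by
    \<open>g\<close> after \<open>h\<close>; then \<open>g\<close> acts on both walks and cancels,
    leaving the single relabelling of the experiment.\<close>
  have inner: "bind_pmf p (\<lambda>w. bind_pmf ?U (\<lambda>h. return_pmf (rendezvous T (map g v) (map h w)))) =
      bind_pmf p (\<lambda>w. bind_pmf ?U (\<lambda>h. return_pmf (rendezvous T v (map h w))))"
    if v: "v \<in> set_pmf p" and g: "g \<in> cycle_aut n" for v g
  proof (rule bind_pmf_cong[OF refl])
    fix w assume w: "w \<in> set_pmf p"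
    have "bind_pmf ?U (\<lambda>h. return_pmf (rendezvous T (map g v) (map h w))) =
        bind_pmf (map_pmf (compose (cycle_verts n) g) ?U)
          (\<lambda>h. return_pmf (rendezvous T (map g v) (map h w)))"
      by (simp add: map_pmf_compose_cycle_aut[OF n g])
    also have "\<dots> = bind_pmf ?U (\<lambda>h. return_pmf
        (rendezvous T (map g v) (map (compose (cycle_verts n) g h) w)))"
      by (simp add: bind_map_pmf)
    also have "\<dots> = bind_pmf ?U (\<lambda>h. return_pmf (rendezvous T v (map h w)))"
    proof (rule bind_pmf_cong[OF refl])
      fix h assume "h \<in> set_pmf ?U"
      then have h: "h \<in> cycle_aut n" by (simp add: set_pmf_cycle_aut)
      have vw: "v \<in> cycle_walks n T" "w \<in> cycle_walks n T" using v w p by auto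
      have "rendezvous T (map g v) (map (compose (cycle_verts n) g h) w) = rendezvous T v (map h w)"
        using rendezvous_map_cycle_aut[OF g vw(1) map_cycle_aut_walk[OF h vw(2)]]
        by (simp only: map_compose_cycle_walk[OF vw(2)])
      then show "return_pmf (rendezvous T (map g v) (map (compose (cycle_verts n) g h) w)) =
          return_pmf (rendezvous T v (map h w))" by simp
    qed
    finally show "bind_pmf ?U (\<lambda>h. return_pmf (rendezvous T (map g v) (map h w))) =
        bind_pmf ?U (\<lambda>h. return_pmf (rendezvous T v (map h w)))" .
  qed
  have "map_pmf (\<lambda>(v, w). rendezvous T v w) (pair_pmf (symmetrised n p) (symmetrised n p)) =
      bind_pmf p (\<lambda>v. bind_pmf ?U (\<lambda>g.
        bind_pmf p (\<lambda>w. bind_pmf ?U (\<lambda>h. return_pmf (rendezvous T (map g v) (map h w))))))"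
    by (simp add: pair_pmf_def symmetrised_def map_pmf_def bind_assoc_pmf bind_return_pmf)
  also have "\<dots> = bind_pmf p (\<lambda>v. bind_pmf ?U (\<lambda>g.
        bind_pmf p (\<lambda>w. bind_pmf ?U (\<lambda>h. return_pmf (rendezvous T v (map h w))))))"
    by (intro bind_pmf_cong refl inner) (simp_all add: set_pmf_cycle_aut)
  also have "\<dots> = map_pmf (\<lambda>(v, w, \<pi>). rendezvous T v (map \<pi> w)) (rendezvous_experiment n p)"
    by (simp add: rendezvous_experiment_def pair_pmf_def map_pmf_def bind_assoc_pmf bind_return_pmf)
  finally have eq: "map_pmf (\<lambda>(v, w). rendezvous T v w)
      (pair_pmf (symmetrised n p) (symmetrised n p)) =
      map_pmf (\<lambda>(v, w, \<pi>). rendezvous T v (map \<pi> w)) (rendezvous_experiment n p)" .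
  \<comment> \<open>The two experiments live on different spaces, so only the laws of their Boolean
    outcome are compared.\<close>
  have "no_rendezvous_prob n T p = measure_pmf.prob
      (map_pmf (\<lambda>(v, w, \<pi>). rendezvous T v (map \<pi> w)) (rendezvous_experiment n p)) {False}"
    unfolding no_rendezvous_prob_def by (auto simp: measure_map_pmf intro!: arg_cong2[where f = measure])
  also have "\<dots> = measure_pmf.prob (pair_pmf (symmetrised n p) (symmetrised n p))
      {(v, w). \<not> rendezvous T v w}"
    unfolding eq[symmetric] by (auto simp: measure_map_pmf intro!: arg_cong2[where f = measure])
  finally show ?thesis .
qed

text \<open>By independence, invariance allows moving the second walk alone. This is what later
  makes all translates equally likely to avoid the first walk.\<close>

lemma prob_pair_symmetrised_map_cycle_aut:
  assumes "g \<in> cycle_aut n"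
  shows "measure_pmf.prob (pair_pmf (symmetrised n p) (symmetrised n p)) {(v, w). P v (map g w)} =
    measure_pmf.prob (pair_pmf (symmetrised n p) (symmetrised n p)) {(v, w). P v w}"
proof -
  let ?Q = "symmetrised n p"
  have "pair_pmf ?Q ?Q = map_pmf (map_prod id (map g)) (pair_pmf ?Q ?Q)"
    using map_pair[of id "map g" ?Q ?Q] map_pmf_symmetrised[OF assms]
    by (simp add: map_prod_def pmf.map_id)
  then have "measure_pmf.prob (pair_pmf ?Q ?Q) {(v, w). P v w} =
      measure_pmf.prob (map_pmf (map_prod id (map g)) (pair_pmf ?Q ?Q)) {(v, w). P v w}"
    by simp
  also have "\<dots> = measure_pmf.prob (pair_pmf ?Q ?Q) {(v, w). P v (map g w)}"
    by (auto simp: measure_map_pmf intro!: arg_cong2[where f = measure])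
  finally show ?thesis by simp
qed

end

section \<open>Distances\<close>

text \<open>\<open>far n e x y\<close>: the representatives \<open>x\<close> and \<open>y\<close> have distance at least \<open>e\<close> on the cycle.\<close>

definition far :: "nat \<Rightarrow> int \<Rightarrow> int \<Rightarrow> int \<Rightarrow> bool" where
  "far n e x y \<longleftrightarrow> (\<forall>j. e \<le> \<bar>x - y - j * int n\<bar>)"

text \<open>Lifts the walk to the integers: \<open>d\<close> is the true displacement and
  \<open>j\<close> corrects for wrapping around the cycle.\<close>

lemma cycle_walk_displacement:
  assumes "v \<in> cycle_walks n T" "a + k \<le> T"
  shows "\<exists>d j. \<bar>d\<bar> \<le> int k \<and> v ! (a + k) = v ! a + d + j * int n"
  using assms(2)
proof (induction k)
  case 0
  show ?case by (intro exI[of _ 0]) simp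
next
  case (Suc k)
  then obtain d j where dj: "\<bar>d\<bar> \<le> int k" "v ! (a + k) = v ! a + d + j * int n" by auto
  have "v ! (a + k + 1) \<in> {(v ! (a + k) - 1) mod int n, v ! (a + k), (v ! (a + k) + 1) mod int n}"
    using assms(1) Suc.prems by (auto simp: cycle_walks_def)
  moreover have "x mod int n = x + (- (x div int n)) * int n" for x
    using div_mult_mod_eq[of x "int n"] by (simp add: algebra_simps)
  ultimately obtain e i where ei: "\<bar>e\<bar> \<le> 1" "v ! (a + k + 1) = v ! (a + k) + e + i * int n"
    by (elim insertE) (metis abs_minus_cancel abs_one order_refl diff_conv_add_uminus,
      metis abs_zero zero_le_one add_0_right mult_zero_left, metis abs_one order_refl, simp)
  show ?case
    using dj ei by (intro exI[of _ "d + e"] exI[of _ "j + i"]) (auto simp: algebra_simps)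
qed

text \<open>Each walk moves at most one unit per step, so the distance drops by at most two.
  Backward time is included, for times before the first anchor.\<close>

lemma far_walks:
  assumes v: "v \<in> cycle_walks n T" and w: "w \<in> cycle_walks n T"
    and at: "a \<le> T" "t \<le> T" and far: "far n e (v ! a) (w ! a)"
  shows "far n (e - 2 * \<bar>int t - int a\<bar>) (v ! t) (w ! t)"
proof -
  have disp: "\<exists>d j. \<bar>d\<bar> \<le> \<bar>int t - int a\<bar> \<and> u ! t = u ! a + d + j * int n"
    if u: "u \<in> cycle_walks n T" for u
  proof (cases "a \<le> t")
    case True
    then show ?thesis using cycle_walk_displacement[OF u, of a "t - a"] at by auto
  next
    case False
    then obtain d j where "\<bar>d\<bar> \<le> int (a - t)" "u ! a = u ! t + d + j * int n"
      using cycle_walk_displacement[OF u, of t "a - t"] at by auto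
    then show ?thesis
      using False by (intro exI[of _ "- d"] exI[of _ "- j"]) auto
  qed
  obtain d j where d: "\<bar>d\<bar> \<le> \<bar>int t - int a\<bar>" "v ! t = v ! a + d + j * int n"
    using disp[OF v] by auto
  obtain d' j' where d': "\<bar>d'\<bar> \<le> \<bar>int t - int a\<bar>" "w ! t = w ! a + d' + j' * int n"
    using disp[OF w] by auto
  show ?thesis unfolding far_def
  proof
    fix i
    \<comment> \<open>The multiple of \<open>n\<close> is chosen so that the wrap counts of both
      walks cancel.\<close>
    have "e \<le> \<bar>v ! a - w ! a - (i - j + j') * int n\<bar>" using far by (simp add: far_def)
    also have "v ! a - w ! a - (i - j + j') * int n = (v ! t - w ! t - i * int n) - (d - d')"
      using d(2) d'(2) by (simp add: algebra_simps)
    finally show "e - 2 * \<bar>int t - int a\<bar> \<le> \<bar>v ! t - w ! t - i * int n\<bar>"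
      using d(1) d'(1) abs_triangle_ineq4[of "v ! t - w ! t - i * int n" "d - d'"]
        abs_triangle_ineq4[of d d'] by linarith
  qed
qed

lemma far_imp_neq: "far n e x y \<Longrightarrow> 0 < e \<Longrightarrow> x \<noteq> y"
  by (auto simp: far_def dest: spec[of _ 0])

lemma far_imp_not_adj:
  assumes "far n e x y" "1 < e"
  shows "\<not> cycle_adj n x y"
proof
  assume "cycle_adj n x y"
  then obtain d where d: "\<bar>d\<bar> = 1" "y = (x + d) mod int n"
    using that[of 1] that[of "- 1"] by (auto simp: cycle_adj_def)
  have "x - y - ((x + d) div int n) * int n = - d"
    using div_mult_mod_eq[of "x + d" "int n"] d by (simp add: algebra_simps)
  then have "\<bar>x - y - ((x + d) div int n) * int n\<bar> = 1" using d(1) by simp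
  then show False using assms unfolding far_def by (metis not_less)
qed

text \<open>Every lift of the arc difference has absolute value at least 2, and positions inside the
  arcs differ by at most \<open>m - 1\<close>, which leaves \<open>2 * m - (m - 1)\<close>.\<close>

lemma far_if_arcs_apart:
  assumes "m > 0" "((x div int m) - (y div int m)) mod 6 \<in> {2, 3, 4}"
  shows "far (6 * m) (int m + 1) x y"
  unfolding far_def
proof
  fix j
  define d where "d = x div int m - y div int m - 6 * j"
  have "d mod 6 \<in> {2, 3, 4}"
    using assms(2) mod_mult_self2[of "x div int m - y div int m" 6 "- j"] by (simp add: d_def)
  then have "d \<noteq> - 1 \<and> d \<noteq> 0 \<and> d \<noteq> 1" by auto
  then have "2 \<le> \<bar>d\<bar>" by linarith
  then have "2 * int m \<le> \<bar>d\<bar> * int m" by (intro mult_right_mono) auto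
  then have 1: "2 * int m \<le> \<bar>d * int m\<bar>" by (simp add: abs_mult)
  have "x - y - j * int (6 * m) = d * int m + (x mod int m - y mod int m)"
    using div_mult_mod_eq[of x "int m"] div_mult_mod_eq[of y "int m"]
    by (simp add: d_def algebra_simps)
  moreover have "0 \<le> x mod int m" "x mod int m < int m" "0 \<le> y mod int m" "y mod int m < int m"
    using assms(1) by auto
  ultimately show "int m + 1 \<le> \<bar>x - y - j * int (6 * m)\<bar>" using 1 by linarith
qed

section \<open>Arc codes\<close>

text \<open>The remainder \<open>T mod m\<close> is split in two, the initial part rounded down and
  the final part rounded up; both are at most half of \<open>m\<close>, since the remainder is at
  most \<open>m - 1\<close>.\<close>

definition anchor :: "nat \<Rightarrow> nat \<Rightarrow> nat \<Rightarrow> nat" where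
  "anchor m T k = (T mod m) div 2 + k * m"

lemma anchor_le: "k \<le> T div m \<Longrightarrow> anchor m T k \<le> T"
proof -
  assume "k \<le> T div m"
  then have "k * m \<le> (T div m) * m" by simp
  then show ?thesis
    using div_mult_mod_eq[of T m] div_le_dividend[of "T mod m" 2] unfolding anchor_def by linarith
qed

text \<open>Time is doubled so that the midpoint of a step can be used as \<open>z\<close>.\<close>

lemma near_anchor:
  assumes m: "m > 0" and z: "z \<le> 2 * T"
  obtains k where "k \<le> T div m" "\<bar>int z - 2 * int (anchor m T k)\<bar> \<le> int m"
proof -
  define r where "r = (T mod m) div 2"
  \<comment> \<open>Rounds to a nearest anchor in doubled time. Truncated subtraction yields
    \<open>k = 0\<close> for times before the first anchor.\<close>
  define k where "k = ((z - 2 * r) + (m - 1)) div (2 * m)"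
  have rm: "T mod m < m" using m by simp
  have r: "2 * r \<le> T mod m" "T mod m \<le> 2 * r + 1" by (auto simp: r_def)
  have T: "T = (T div m) * m + T mod m" by simp
  \<comment> \<open>Here the halving pays off: \<open>2 * (T mod m) - 2 * r\<close> is at most
    \<open>T mod m + 1\<close>, hence at most \<open>m\<close>, so rounding never passes the last
    anchor.\<close>
  have ub: "(z - 2 * r) + (m - 1) < (T div m + 1) * (2 * m)"
  proof -
    have "z \<le> 2 * ((T div m) * m) + 2 * (T mod m)" using z T by linarith
    moreover have "(T div m + 1) * (2 * m) = 2 * ((T div m) * m) + 2 * m" by (simp add: algebra_simps)
    ultimately show ?thesis using r rm m by linarith
  qed
  have "k < T div m + 1"
    unfolding k_def using ub m by (simp add: div_less_iff_less_mult)
  moreover have "\<bar>int z - 2 * int (anchor m T k)\<bar> \<le> int m"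
  proof -
    define s where "s = ((z - 2 * r) + (m - 1)) mod (2 * m)"
    have s: "s < 2 * m" using m by (simp add: s_def)
    have "(z - 2 * r) + (m - 1) = 2 * (k * m) + s"
      using div_mult_mod_eq[of "(z - 2 * r) + (m - 1)" "2 * m"] by (simp add: k_def s_def algebra_simps)
    moreover have "k = 0" if "z < 2 * r" using that m by (simp add: k_def)
    moreover have "anchor m T k = r + k * m" by (simp add: anchor_def r_def)
    ultimately have "z + m \<le> 2 * anchor m T k + 2 * m" "2 * anchor m T k \<le> z + m"
      using s m r rm by (cases "z < 2 * r"; simp; linarith)+
    then show ?thesis by linarith
  qed
  ultimately show ?thesis using that[of k] by simp
qed

text \<open>Only increments are recorded, not the initial arc, so the arc difference of two walks
  with equal codes can still be shifted by translation.\<close>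

definition arc_code :: "nat \<Rightarrow> nat \<Rightarrow> int list \<Rightarrow> int list" where
  "arc_code m T v = map (\<lambda>k. (v ! anchor m T (Suc k) div int m - v ! anchor m T k div int m) mod 6)
     [0..<T div m]"

text \<open>A displacement of at most \<open>m\<close> changes the quotient by \<open>m\<close> by
  at most 1, by monotonicity; wrapping adds a multiple of 6. The value 5 stands for
  \<open>-1\<close>.\<close>

lemma arc_code_mem:
  assumes m: "m > 0" and v: "v \<in> cycle_walks (6 * m) T"
  shows "arc_code m T v \<in> {xs. set xs \<subseteq> {0, 1, 5} \<and> length xs = T div m}"
proof -
  have "(v ! anchor m T (Suc k) div int m - v ! anchor m T k div int m) mod 6 \<in> {0, 1, 5}"
    if k: "k < T div m" for k
  proof -
    define x where "x = v ! anchor m T k"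
    have a: "anchor m T (Suc k) = anchor m T k + m" by (simp add: anchor_def)
    then obtain d j where d: "\<bar>d\<bar> \<le> int m" "v ! anchor m T (Suc k) = x + d + j * int (6 * m)"
      using cycle_walk_displacement[OF v, of "anchor m T k" m] anchor_le[of "Suc k" T m] k
      by (auto simp: x_def)
    define e where "e = (x + d) div int m - x div int m"
    have "x + d + j * int (6 * m) = (x + d) + (6 * j) * int m" by simp
    then have e1: "v ! anchor m T (Suc k) div int m - x div int m = e + 6 * j"
      using m d(2) by (simp only: div_mult_self1 e_def)
    have "x div int m - 1 \<le> (x + d) div int m" "(x + d) div int m \<le> x div int m + 1"
      using zdiv_mono1[of "x + (- 1) * int m" "x + d" "int m"]
        zdiv_mono1[of "x + d" "x + 1 * int m" "int m"] m d(1)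
      by (simp_all only: div_mult_self1) (simp_all add: add.commute)
    then have "e = -1 \<or> e = 0 \<or> e = 1" unfolding e_def by linarith
    then show ?thesis unfolding x_def[symmetric] e1 by auto
  qed
  then have "(\<lambda>k. (v ! anchor m T (Suc k) div int m - v ! anchor m T k div int m) mod 6) ` {0..<T div m}
      \<subseteq> {0, 1, 5}" by (intro image_subsetI) simp
  then show ?thesis by (simp add: arc_code_def)
qed

lemma arc_code_eq_imp_const_diff:
  assumes "arc_code m T v = arc_code m T w" "k \<le> T div m"
  shows "(v ! anchor m T k div int m - w ! anchor m T k div int m) mod 6 =
    (v ! anchor m T 0 div int m - w ! anchor m T 0 div int m) mod 6"
  using assms(2)
proof (induction k)
  case (Suc k)
  let ?v = "\<lambda>k. v ! anchor m T k div int m" and ?w = "\<lambda>k. w ! anchor m T k div int m"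
  have "(?v (Suc k) - ?v k) mod 6 = (?w (Suc k) - ?w k) mod 6"
    using arg_cong[OF assms(1), of "\<lambda>xs. xs ! k"] Suc.prems by (simp add: arc_code_def)
  then have "(?v (Suc k) - ?w (Suc k)) mod 6 = (?v k - ?w k) mod 6"
    by (simp add: mod_eq_dvd_iff algebra_simps)
  with Suc show ?case by simp
qed simp

text \<open>Within time \<open>m / 2\<close> of an anchor the two walks together use up at most
  \<open>m\<close> of the initial distance \<open>m + 1\<close>, so they cannot meet.\<close>

lemma not_rendezvous_if_arcs_apart:
  assumes m: "m > 0" and v: "v \<in> cycle_walks (6 * m) T" and w: "w \<in> cycle_walks (6 * m) T"
    and apart: "\<And>k. k \<le> T div m \<Longrightarrow>
      (v ! anchor m T k div int m - w ! anchor m T k div int m) mod 6 \<in> {2, 3, 4}"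
  shows "\<not> rendezvous T v w"
proof -
  have far: "far (6 * m) (int m + 1 - 2 * \<bar>int t - int (anchor m T k)\<bar>) (v ! t) (w ! t)"
    if "k \<le> T div m" "t \<le> T" for k t
    using far_walks[OF v w anchor_le[OF that(1)] that(2) far_if_arcs_apart[OF m apart[OF that(1)]]] .
  have "v ! t \<noteq> w ! t" if t: "t \<le> T" for t
  proof -
    obtain k where k: "k \<le> T div m" "\<bar>int (2 * t) - 2 * int (anchor m T k)\<bar> \<le> int m"
      using near_anchor[OF m, of "2 * t" T] t by auto
    have "\<bar>int (2 * t) - 2 * int (anchor m T k)\<bar> = 2 * \<bar>int t - int (anchor m T k)\<bar>"
      by (simp add: abs_if)
    with k(2) have "0 < int m + 1 - 2 * \<bar>int t - int (anchor m T k)\<bar>" by linarith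
    then show ?thesis by (rule far_imp_neq[OF far[OF k(1) t]])
  qed
  moreover have "\<not> (v ! t \<noteq> v ! (t + 1) \<and> v ! t = w ! (t + 1) \<and> v ! (t + 1) = w ! t)"
    if t: "t < T" for t
  proof
    assume swap: "v ! t \<noteq> v ! (t + 1) \<and> v ! t = w ! (t + 1) \<and> v ! (t + 1) = w ! t"
    \<comment> \<open>A swap forces the walks to be adjacent at both ends of the step. The midpoint
      is within \<open>m / 2\<close> of an anchor, so the end on the anchor's side is within
      \<open>(m - 1) / 2\<close>, where the distance is still at least 2.\<close>
    then have adj: "cycle_adj (6 * m) (v ! t) (w ! t)" "cycle_adj (6 * m) (v ! (t + 1)) (w ! (t + 1))"
      using v w t unfolding cycle_walks_iff_adj by metis+
    obtain k where k: "k \<le> T div m" "\<bar>int (2 * t + 1) - 2 * int (anchor m T k)\<bar> \<le> int m"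
      using near_anchor[OF m, of "2 * t + 1" T] t by auto
    show False
    proof (cases "anchor m T k \<le> t")
      case True
      then show False
        using far_imp_not_adj[OF far[OF k(1), of t]] adj(1) k(2) t by auto
    next
      case False
      then show False
        using far_imp_not_adj[OF far[OF k(1), of "t + 1"]] adj(2) k(2) t by auto
    qed
  qed
  ultimately show ?thesis unfolding rendezvous_def by blast
qed

section \<open>Translations by whole arcs\<close>

definition cycle_translate :: "nat \<Rightarrow> int \<Rightarrow> int \<Rightarrow> int" where
  "cycle_translate n s = restrict (\<lambda>x. (x + s) mod int n) (cycle_verts n)"

lemma cycle_translate_aut: "n \<ge> 3 \<Longrightarrow> cycle_translate n s \<in> cycle_aut n"
  using dihedral_in_cycle_aut[of n 1 s] by (simp add: cycle_translate_def)

lemma div_cycle_translate: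
  assumes "m > 0" "x \<in> cycle_verts (6 * m)"
  shows "cycle_translate (6 * m) (i * int m) x div int m mod 6 = (x div int m + i) mod 6"
proof -
  define y where "y = x + i * int m"
  have "y mod int (6 * m) = y + (- 6 * (y div int (6 * m))) * int m"
    using div_mult_mod_eq[of y "int (6 * m)"] by (simp add: algebra_simps)
  then have "y mod int (6 * m) div int m = y div int m + - 6 * (y div int (6 * m))"
    using assms(1) by (simp only: div_mult_self1)
  moreover have "y div int m = x div int m + i"
    using assms(1) by (simp add: y_def)
  moreover have "(a + - 6 * b) mod 6 = a mod (6::int)" for a b by presburger
  ultimately show ?thesis
    using assms(2) by (simp add: cycle_translate_def y_def)
qed

text \<open>Source of the factor one half: equal codes give a constant arc difference
  \<open>d\<close>, translation by \<open>i\<close> arcs turns it into \<open>d - i\<close>, and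
  three of the six residues \<open>i\<close> make this 2, 3 or 4.\<close>

lemma three_translates_avoid:
  assumes m: "m > 0" and v: "v \<in> cycle_walks (6 * m) T" and w: "w \<in> cycle_walks (6 * m) T"
    and code: "arc_code m T v = arc_code m T w"
  shows "3 \<le> card {i \<in> {0..<6::int}. \<not> rendezvous T v (map (cycle_translate (6 * m) (i * int m)) w)}"
proof -
  define d where "d = (v ! anchor m T 0 div int m - w ! anchor m T 0 div int m) mod 6"
  let ?I = "{i \<in> {0..<6::int}. (d - i) mod 6 \<in> {2, 3, 4}}"
  let ?J = "{i \<in> {0..<6::int}. \<not> rendezvous T v (map (cycle_translate (6 * m) (i * int m)) w)}"
  have fin: "finite {i \<in> {0..<6::int}. P i}" for P
    by (rule finite_subset[of _ "{0..<6}"]) auto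
  have "\<not> rendezvous T v (map (cycle_translate (6 * m) (i * int m)) w)"
    if i: "(d - i) mod 6 \<in> {2, 3, 4}" for i
  proof (rule not_rendezvous_if_arcs_apart[OF m v])
    show "map (cycle_translate (6 * m) (i * int m)) w \<in> cycle_walks (6 * m) T"
      using m by (intro map_cycle_aut_walk[OF cycle_translate_aut w]) simp
    fix k assume k: "k \<le> T div m"
    let ?a = "anchor m T k"
    have a: "?a < length w" using anchor_le[OF k] w by (simp add: cycle_walks_def)
    have tr: "map (cycle_translate (6 * m) (i * int m)) w ! ?a = cycle_translate (6 * m) (i * int m) (w ! ?a)"
      using a by simp
    have "(v ! ?a div int m - map (cycle_translate (6 * m) (i * int m)) w ! ?a div int m) mod 6 =
        (v ! ?a div int m - (w ! ?a div int m + i)) mod 6"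
      unfolding tr
      by (rule mod_diff_cong[OF refl div_cycle_translate[OF m cycle_walks_nth_mem[OF w anchor_le[OF k]]]])
    also have "\<dots> = ((v ! ?a div int m - w ! ?a div int m) mod 6 - i) mod 6"
      by (simp add: mod_diff_left_eq diff_diff_eq)
    also have "\<dots> = (d - i) mod 6"
      unfolding d_def by (simp only: arc_code_eq_imp_const_diff[OF code k])
    finally show "(v ! ?a div int m - map (cycle_translate (6 * m) (i * int m)) w ! ?a div int m) mod 6
        \<in> {2, 3, 4}" using i by simp
  qed
  then have "?I \<subseteq> ?J" by blast
  then have "card ?I \<le> card ?J" by (rule card_mono[OF fin])
  moreover have "3 \<le> card ?I"
  proof -
    \<comment> \<open>The reflection \<open>j\<close> to \<open>d - j\<close> is an involution
      modulo 6, so it carries the good differences to the good translations.\<close>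
    have "(d - (d - j) mod 6) mod 6 = j mod 6" for j by (simp add: mod_diff_right_eq)
    then have "(\<lambda>j. (d - j) mod 6) ` {2, 3, 4} \<subseteq> ?I" by auto
    then have "card ((\<lambda>j. (d - j) mod 6) ` {2, 3, 4}) \<le> card ?I"
      by (rule card_mono[OF fin])
    moreover have "inj_on (\<lambda>j. (d - j) mod 6) {2, 3, 4}" by (auto simp: inj_on_def mod_eq_dvd_iff)
    ultimately show ?thesis by (simp add: card_image)
  qed
  ultimately show ?thesis by simp
qed

section \<open>The bound\<close>

text \<open>Double counting over the six translations: every \<open>E i\<close> has the same
  probability, and pairs with equal codes lie in at least three of these events.\<close>

lemma no_rendezvous_prob_ge:
  assumes m: "m > 0" and p: "symmetric_strategy (6 * m) T p"
  shows "1 / 2 * (1 / 3 ^ (T div m)) \<le> no_rendezvous_prob (6 * m) T p"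
proof -
  define Q where "Q = symmetrised (6 * m) p"
  define E where "E i = {(v, w). \<not> rendezvous T v (map (cycle_translate (6 * m) (i * int m)) w)}" for i
  let ?C = "{xs. set xs \<subseteq> {0, 1, 5::int} \<and> length xs = T div m}"
  have n: "6 * m \<ge> 3" using m by simp
  have walks: "set_pmf p \<subseteq> cycle_walks (6 * m) T" using p by (simp add: symmetric_strategy_def)
  have Q: "set_pmf Q \<subseteq> cycle_walks (6 * m) T"
    unfolding Q_def by (rule set_pmf_symmetrised[OF n walks])
  have "card ?C = 3 ^ (T div m)" by (subst card_lists_length_eq) (auto simp: numeral_3_eq_3)
  moreover have "finite ?C" by (rule finite_lists_length_eq) simp
  moreover have "set_pmf (map_pmf (arc_code m T) Q) \<subseteq> ?C"
    using Q arc_code_mem[OF m] by fastforce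
  ultimately have "1 / 3 ^ (T div m) \<le>
      measure_pmf.prob (pair_pmf (map_pmf (arc_code m T) Q) (map_pmf (arc_code m T) Q)) {(x, y). x = y}"
    using prob_pair_pmf_eq_ge[of ?C] by fastforce
  also have "\<dots> = measure_pmf.prob (pair_pmf Q Q) {(v, w). arc_code m T v = arc_code m T w}"
    by (auto simp: pair_map_pmf1 pair_map_pmf2 measure_map_pmf intro!: arg_cong2[where f = measure])
  finally have code: "1 / 3 ^ (T div m) \<le>
    measure_pmf.prob (pair_pmf Q Q) {(v, w). arc_code m T v = arc_code m T w}" .
  have ind: "integrable (measure_pmf (pair_pmf Q Q)) (indicat_real A)" for A
    by (rule measure_pmf.integrable_const_bound[where B = 1]) auto
  have "3 * measure_pmf.prob (pair_pmf Q Q) {(v, w). arc_code m T v = arc_code m T w} =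
      measure_pmf.expectation (pair_pmf Q Q)
        (\<lambda>z. 3 * indicat_real {(v, w). arc_code m T v = arc_code m T w} z)"
    by simp
  also have "\<dots> \<le> measure_pmf.expectation (pair_pmf Q Q) (\<lambda>z. \<Sum>i\<in>{0..<6}. indicat_real (E i) z)"
  proof (intro integral_mono_AE AE_pmfI)
    show "3 * indicat_real {(v, w). arc_code m T v = arc_code m T w} z \<le>
        (\<Sum>i\<in>{0..<6}. indicat_real (E i) z)" if "z \<in> set_pmf (pair_pmf Q Q)" for z
    proof -
      obtain v w where z: "z = (v, w)" by (cases z)
      have vw: "v \<in> cycle_walks (6 * m) T" "w \<in> cycle_walks (6 * m) T" using that Q z by auto
      have "(\<Sum>i\<in>{0..<6}. indicat_real (E i) z) = real (card ({0..<6} \<inter> {i. z \<in> E i}))"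
        by (simp add: indicator_def)
      also have "{0..<6} \<inter> {i. z \<in> E i} = {i \<in> {0..<6::int}.
          \<not> rendezvous T v (map (cycle_translate (6 * m) (i * int m)) w)}"
        by (auto simp: z E_def)
      finally show ?thesis
        using three_translates_avoid[OF m vw] by (auto simp: z indicator_def)
    qed
  qed (intro Bochner_Integration.integrable_sum integrable_mult_right ind)+
  also have "\<dots> = (\<Sum>i\<in>{0..<6}. measure_pmf.prob (pair_pmf Q Q) (E i))"
    by (subst Bochner_Integration.integral_sum) (auto intro: ind)
  also have "\<dots> = (\<Sum>i\<in>{0..<6::int}. no_rendezvous_prob (6 * m) T p)"
    unfolding E_def Q_def no_rendezvous_prob_symmetrised[OF n walks]
    by (intro sum.cong refl
      prob_pair_symmetrised_map_cycle_aut[OF n walks cycle_translate_aut[OF n], where P = "\<lambda>v w. \<not> rendezvous T v w"])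
  finally show ?thesis using code by simp
qed

theorem theorem18:
  fixes n T :: nat and p :: "int list pmf"
  assumes "n > 0" and "6 dvd n" and "symmetric_strategy n T p"
  shows "no_rendezvous_prob n T p \<ge> 1 / 2 * 3 powr (- 6 * real T / real n)"
proof -
  obtain m where n: "n = 6 * m" using assms(2) by blast
  then have m: "m > 0" using assms(1) by simp
  \<comment> \<open>Since \<open>n = 6 * m\<close>, the exponent \<open>6 * T / n\<close> is
    \<open>T / m\<close>, and rounding it down only strengthens the bound.\<close>
  have "real (T div m) \<le> real T / real m" by (rule of_nat_div_le_of_nat)
  then have "3 powr (- 6 * real T / real n) \<le> 3 powr (- real (T div m))"
    using m by (intro powr_mono) (auto simp: n)
  also have "\<dots> = 1 / 3 ^ (T div m)"
    by (simp add: powr_minus powr_realpow divide_inverse)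
  finally show ?thesis
    using no_rendezvous_prob_ge[OF m assms(3)[unfolded n]] unfolding n by linarith
qed

end
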